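(* For every integer $n\ge 2$ and all integers $r,k\in\mathbb{Z}$, $$n\,s_{n}^{(r,k)}(x)+n\left(\frac{1}{2}r-x\right)s_{n-1}^{(r,k)}(x)+r\sum_{l=0}^{n-2}(-1)^{n-l}\binom{n}{l}B_{n-l}\,s_{l}^{(r,k)}(x)=-s_{n}^{(r+1,k)}(x)+s_{n}^{(r+1,k-1)}(x)$$ as polynomials in $x$.
   Context: For $k\in\mathbb{Z}$, $Li_k(x)=\sum_{n=1}^{\infty}\frac{x^n}{n^k}$ is the polylogarithm, regarded as a formal power series; $\frac{Li_k(1-e^{-t})}{1-e^{-t}}$ is then a formal power series in $t$ over $\mathbb{C}$. The ordinary Bernoulli numbers $B_n$ are defined by $\frac{t}{e^t-1}=\sum_{n\ge0}B_n\frac{t^n}{n!}$ (so $B_1=-\tfrac12$). For $r,k\in\mathbb{Z}$, the higher-order Bernoulli and poly-Bernoulli mixed type polynomials $s_n^{(r,k)}(x)$ are defined by $\left(\frac{t}{e^t-1}\right)^r\frac{Li_k(1-e^{-t})}{1-e^{-t}}e^{xt}=\sum_{n\ge0}s_n^{(r,k)}(x)\frac{t^n}{n!}$. *)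

theory Defs
  imports Complex_Main "HOL-Computational_Algebra.Computational_Algebra"
begin

definition polylog_fps :: "int \<Rightarrow> complex fps" where
  "polylog_fps k = Abs_fps (\<lambda>n. if n = 0 then 0 else 1 / of_nat n powi k)"

(* The denominators below have zero constant term.  Division is the library's fps division,
   which first cancels the power of the variable in the denominator; as the numerators vanish
   at 0 too, it is exact division in the ring of power series. *)

definition bernoulli_fps :: "complex fps" where
  "bernoulli_fps = fps_X / (fps_exp 1 - 1)"

definition bernoulli_number :: "nat \<Rightarrow> complex" where
  "bernoulli_number n = fact n * fps_nth bernoulli_fps n"

definition poly_bernoulli_fps :: "int \<Rightarrow> complex fps" where
  "poly_bernoulli_fps k =
     fps_compose (polylog_fps k) (1 - fps_exp (-1)) / (1 - fps_exp (-1))"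

(* The polynomials in x live in power series in t with coefficients in complex poly:
   scalar series are embedded coefficientwise, and e^(x t) has t^n-coefficient x^n / n!. *)

definition fps_to_poly_fps :: "complex fps \<Rightarrow> complex poly fps" where
  "fps_to_poly_fps f = Abs_fps (\<lambda>n. [:fps_nth f n:])"

definition exp_xt_fps :: "complex poly fps" where
  "exp_xt_fps = Abs_fps (\<lambda>n. monom (1 / fact n) n)"

definition mixed_bernoulli_fps :: "int \<Rightarrow> int \<Rightarrow> complex poly fps" where
  "mixed_bernoulli_fps r k =
     fps_to_poly_fps (bernoulli_fps powi r * poly_bernoulli_fps k) * exp_xt_fps"

definition mixed_bernoulli_poly :: "int \<Rightarrow> int \<Rightarrow> nat \<Rightarrow> complex poly" where
  "mixed_bernoulli_poly r k n = smult (fact n) (fps_nth (mixed_bernoulli_fps r k) n)"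

lemma subdegree_exp_diff:
  assumes "c \<noteq> (0 :: complex)"
  shows "subdegree (fps_exp c - 1) = 1" and "subdegree (1 - fps_exp c) = 1"
  using assms by (intro subdegreeI; auto)+

lemma bernoulli_fps_mult: "bernoulli_fps * (fps_exp 1 - 1) = fps_X"
  unfolding bernoulli_fps_def
proof (rule dvd_div_mult_self)
  have "fps_exp 1 - 1 \<noteq> (0 :: complex fps)"
    using subdegree_exp_diff(1)[of 1] by auto
  thus "fps_exp 1 - 1 dvd (fps_X :: complex fps)"
    by (simp add: fps_dvd_iff subdegree_exp_diff)
qed

lemma bernoulli_fps_nth_0: "fps_nth bernoulli_fps 0 = 1"
proof -
  have "fps_nth (bernoulli_fps * (fps_exp 1 - 1)) 1 = 1"
    by (simp add: bernoulli_fps_mult)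
  thus ?thesis by (simp add: fps_mult_nth)
qed

lemma bernoulli_fps_powi_minus:
  "bernoulli_fps powi r * bernoulli_fps powi (-r) = 1"
proof -
  have "bernoulli_fps * inverse bernoulli_fps = 1"
    using inverse_mult_eq_1[of bernoulli_fps] by (simp add: bernoulli_fps_nth_0 mult.commute)
  thus ?thesis
    by (cases "r = 0") (auto simp: power_int_def mult.commute simp flip: power_mult_distrib)
qed

lemma poly_bernoulli_fps_mult:
  "poly_bernoulli_fps k * (1 - fps_exp (-1)) = fps_compose (polylog_fps k) (1 - fps_exp (-1))"
proof -
  have sd: "subdegree (1 - fps_exp (-1 :: complex)) = 1"
    by (simp add: subdegree_exp_diff)
  have nz: "1 - fps_exp (-1 :: complex) \<noteq> 0"
    using sd by auto
  have "fps_nth (fps_compose (polylog_fps k) (1 - fps_exp (-1))) 0 = 0"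
    by (simp add: polylog_fps_def)
  hence "(1 - fps_exp (-1)) dvd fps_compose (polylog_fps k) (1 - fps_exp (-1))"
    using nz sd subdegree_eq_0_iff[of "fps_compose (polylog_fps k) (1 - fps_exp (-1))"]
    by (cases "fps_compose (polylog_fps k) (1 - fps_exp (-1)) = 0") (auto simp: fps_dvd_iff)
  thus ?thesis
    unfolding poly_bernoulli_fps_def by (rule dvd_div_mult_self)
qed

(* For each complex x, the values of the polynomials satisfy the usual generating-function
   identity in complex fps. *)
lemma mixed_bernoulli_poly_generating_function:
  "Abs_fps (\<lambda>n. poly (mixed_bernoulli_poly r k n) x / fact n) =
     bernoulli_fps powi r * poly_bernoulli_fps k * fps_exp x"
  by (rule fps_ext)
     (simp add: mixed_bernoulli_poly_def mixed_bernoulli_fps_def fps_to_poly_fps_def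
        exp_xt_fps_def fps_mult_nth poly_sum poly_monom)

end

(* Fix x and let F = b^r P_k e^(xt) be the generating function, with b = t / (e^t - 1) and
   P_k = Li_k(u) / u, u = 1 - e^(-t).  The identity is the coefficient form of the expression
   for t F' given by the product rule.  It uses t b' / b = 1 - t - b, where b + t = b(-t), and
   t P_k' = b (P_(k-1) - P_k), which follows from u Li_k'(u) = Li_(k-1)(u). *)
theory Submission
  imports Defs
begin

text \<open>Power series over a field do not form a field. For negative \<open>r\<close> the law
  rests on \<open>inverse f * f = 1\<close>, which holds because the constant term is
  nonzero.\<close>

lemma fps_power_int_add_1:
  fixes f :: "'a::field fps"
  assumes "fps_nth f 0 \<noteq> 0"
  shows "f powi (r + 1) = f powi r * f"
proof (cases "r \<ge> 0")
  case True
  then show ?thesis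
    by (simp add: power_int_def nat_add_distrib)
next
  case False
  \<comment> \<open>Chosen so that \<open>r\<close> is \<open>-(m + 1)\<close> and
    \<open>r + 1\<close> is \<open>-m\<close>: one factor \<open>inverse f\<close> is left to cancel
    against \<open>f\<close>.\<close>
  define m where "m = nat (- r - 1)"
  have r: "r = - int (Suc m)"
    using False by (simp add: m_def)
  have inv: "inverse f * f = 1"
    using assms by (rule inverse_mult_eq_1)
  have "f powi r * f = inverse f ^ m * (inverse f * f)"
    by (simp add: r power_int_def nat_add_distrib ac_simps del: of_nat_Suc)
  also have "\<dots> = f powi (r + 1)"
    by (simp add: r power_int_def inv)
  finally show ?thesis ..
qed

text \<open>The power rule multiplied through by \<open>f\<close>, so that no exponent
  \<open>r - 1\<close> occurs. Induction on \<open>r\<close> runs upwards and downwards from 0,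
  using the product rule for \<open>f powi i * f\<close>.\<close>

lemma fps_deriv_power_int:
  fixes f :: "'a::field fps"
  assumes "fps_nth f 0 \<noteq> 0"
  shows "fps_deriv (f powi r) * f = of_int r * fps_deriv f * f powi r"
proof -
  have nz: "f \<noteq> 0"
    using assms by auto
  have deriv_next: "fps_deriv (f powi (i + 1)) = fps_deriv (f powi i) * f + f powi i * fps_deriv f"
    for i
    unfolding fps_power_int_add_1[OF assms] by simp
  show ?thesis
  proof (induction r rule: int_induct[where k = 0])
    case (step1 i)
    show ?case
      unfolding deriv_next step1.IH
      unfolding fps_power_int_add_1[OF assms] by (simp add: algebra_simps)
  next
    case (step2 i)
    have "fps_deriv (f powi i) * f = of_int i * fps_deriv f * f powi i"
      by (rule step2.IH)
    \<comment> \<open>The extra factor \<open>f\<close> lets the product rule for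
      \<open>f powi (i - 1) * f\<close> bring in the induction hypothesis at \<open>i\<close>; it is
      cancelled afterwards.\<close>
    then have "(fps_deriv (f powi (i - 1)) * f) * f = (of_int (i - 1) * fps_deriv f * f powi (i - 1)) * f"
      using deriv_next[of "i - 1"] fps_power_int_add_1[OF assms, of "i - 1"]
      by (simp add: algebra_simps)
    then show ?case
      using nz by simp
  qed simp
qed

lemma fps_exp_mult_minus: "fps_exp 1 * fps_exp (-1) = (1 :: complex fps)"
  using fps_exp_add_mult[of "1 :: complex" "-1"] by simp

lemma fps_exp_1_minus_1_neq_0: "fps_exp 1 - 1 \<noteq> (0 :: complex fps)"
  using subdegree_exp_diff(1)[of 1] by auto

text \<open>Differentiating \<open>b * (e - 1) = fps_X\<close> leaves \<open>e\<close> only in the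
  product \<open>b * e\<close>, which is \<open>fps_X + b\<close>. Cancelling \<open>e - 1\<close>
  then removes the exponential.\<close>

lemma bernoulli_fps_deriv:
  "fps_X * fps_deriv bernoulli_fps = (1 - fps_X - bernoulli_fps) * bernoulli_fps"
proof -
  define e :: "complex fps" where "e = fps_exp 1"
  define b where "b = bernoulli_fps"
  have be: "b * (e - 1) = fps_X"
    by (simp add: b_def e_def bernoulli_fps_mult)
  have "fps_deriv (b * (e - 1)) = 1"
    by (simp add: be)
  then have d: "fps_deriv b * (e - 1) + b * e = 1"
    by (simp add: e_def algebra_simps)
  have "(fps_X * fps_deriv b) * (e - 1) = fps_X * (1 - b * e)"
    using d by (simp add: eq_diff_eq mult.assoc flip: distrib_left)
  also have "b * e = fps_X + b"
    using be by (simp add: algebra_simps)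
  also have "fps_X * (1 - (fps_X + b)) = ((1 - fps_X - b) * b) * (e - 1)"
    by (simp flip: be add: algebra_simps)
  finally show ?thesis
    using fps_exp_1_minus_1_neq_0 by (simp add: b_def e_def)
qed

text \<open>Both sides are b(-t): substituting -t into \<open>b * (e - 1) = fps_X\<close> and
  multiplying by e^t gives \<open>c * (e - 1) = fps_X * e\<close>, which \<open>b + fps_X\<close>
  satisfies too. This is the source of the signs in the theorem.\<close>

lemma bernoulli_fps_reflect:
  "bernoulli_fps + fps_X = Abs_fps (\<lambda>n. (-1) ^ n * bernoulli_number n / fact n)"
proof -
  define e e' :: "complex fps" where "e = fps_exp 1" and "e' = fps_exp (-1)"
  define b where "b = bernoulli_fps"
  define c where "c = fps_compose b (- fps_X)"
  have be: "b * (e - 1) = fps_X"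
    by (simp add: b_def e_def bernoulli_fps_mult)
  have ee': "e * e' = 1"
    by (simp add: e_def e'_def fps_exp_mult_minus)
  have "fps_compose (b * (e - 1)) (- fps_X) = - fps_X"
    by (simp add: be)
  moreover have "fps_compose e (- fps_X) = e'"
    using fps_exp_compose_linear[of 1 "-1 :: complex"] by (simp add: e_def e'_def)
  ultimately have "c * (e' - 1) = - fps_X"
    by (simp add: c_def fps_compose_mult_distrib fps_compose_sub_distrib)
  then have "c * (e' - 1) * e = - fps_X * e"
    by simp
  then have "c * (e - 1) = fps_X * e"
    using ee' by (simp add: algebra_simps)
  also have "\<dots> = (b + fps_X) * (e - 1)"
    using be by (simp add: algebra_simps)
  finally have "c = b + fps_X"
    using fps_exp_1_minus_1_neq_0 by (simp add: e_def)
  moreover have "fps_nth c n = (-1) ^ n * bernoulli_number n / fact n" for n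
    by (simp add: c_def b_def fps_compose_uminus' bernoulli_number_def)
  ultimately show ?thesis
    by (simp add: b_def fps_eq_iff)
qed

lemma bernoulli_number_0: "bernoulli_number 0 = 1"
  by (simp add: bernoulli_number_def bernoulli_fps_nth_0)

lemma bernoulli_number_1: "bernoulli_number 1 = - 1 / 2"
proof -
  \<comment> \<open>The reflection formula read at degree 1 is B_1 + 1 = -B_1.\<close>
  have "fps_nth (bernoulli_fps + fps_X) 1 = - bernoulli_number 1"
    by (simp add: bernoulli_fps_reflect)
  then have "2 * bernoulli_number 1 + 1 = 0"
    by (simp add: bernoulli_number_def)
  then show ?thesis
    by (simp add: eq_neg_iff_add_eq_0 field_simps)
qed

lemma fps_X_mult_deriv_polylog: "fps_X * fps_deriv (polylog_fps k) = polylog_fps (k - 1)"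
proof (rule fps_ext)
  fix n
  show "fps_nth (fps_X * fps_deriv (polylog_fps k)) n = fps_nth (polylog_fps (k - 1)) n"
    by (cases n) (auto simp: polylog_fps_def power_int_diff field_simps simp del: of_nat_Suc)
qed

text \<open>Differentiate P_k u = Li_k(u) by the chain rule, with u' = e^(-t).\<close>

lemma poly_bernoulli_fps_deriv:
  "fps_X * fps_deriv (poly_bernoulli_fps k)
     = bernoulli_fps * (poly_bernoulli_fps (k - 1) - poly_bernoulli_fps k)"
proof -
  define e e' :: "complex fps" where "e = fps_exp 1" and "e' = fps_exp (-1)"
  define u where "u = 1 - e'"
  define P where "P = poly_bernoulli_fps"
  define D where "D = fps_compose (fps_deriv (polylog_fps k)) u"
  have u0: "fps_nth u 0 = 0"
    by (simp add: u_def e'_def)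
  have "u \<noteq> 0"
    using subdegree_exp_diff(2)[of "-1"] by (auto simp: u_def e'_def)
  have Pu: "P j * u = fps_compose (polylog_fps j) u" for j
    by (simp add: P_def u_def e'_def poly_bernoulli_fps_mult)
  have du: "fps_deriv u = e'"
    by (simp add: u_def e'_def flip: fps_const_neg)
  \<comment> \<open>Both \<open>D\<close> and \<open>P (k - 1)\<close> give Li_(k-1)(u) when
    multiplied by \<open>u\<close>.\<close>
  have "u * D = fps_compose (fps_X * fps_deriv (polylog_fps k)) u"
    using u0 by (simp add: D_def fps_compose_mult_distrib)
  also have "\<dots> = u * P (k - 1)"
    unfolding fps_X_mult_deriv_polylog Pu[symmetric] by (rule mult.commute)
  finally have D: "D = P (k - 1)"
    using \<open>u \<noteq> 0\<close> by simp
  have ee': "e * e' = 1"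
    by (simp add: e_def e'_def fps_exp_mult_minus)
  have eu: "e * u = e - 1"
    by (simp add: u_def ee' right_diff_distrib)
  have "fps_deriv (P k * u) = D * e'"
    using u0 by (simp add: Pu D_def fps_compose_deriv du)
  then have "fps_deriv (P k) * u = (P (k - 1) - P k) * e'"
    by (simp add: D du algebra_simps)
  \<comment> \<open>Multiplying by e^t cancels \<open>e'\<close> and turns \<open>u\<close> into
    \<open>e - 1\<close>, which the Bernoulli series then converts to \<open>fps_X\<close>.\<close>
  then have "fps_deriv (P k) * (e * u) = (P (k - 1) - P k) * (e * e')"
    by (metis mult.commute mult.left_commute)
  then have "fps_deriv (P k) * (e - 1) = P (k - 1) - P k"
    by (simp add: eu ee')
  then have "bernoulli_fps * (P (k - 1) - P k) = fps_deriv (P k) * (bernoulli_fps * (e - 1))"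
    by (simp add: ac_simps)
  then show ?thesis
    by (simp add: P_def e_def bernoulli_fps_mult mult.commute)
qed

text \<open>With \<open>x\<close> a fixed number, the calculus takes place over the complex numbers
  instead of over \<open>complex poly\<close>.\<close>

definition mixed_bernoulli_egf :: "int \<Rightarrow> int \<Rightarrow> complex \<Rightarrow> complex fps" where
  "mixed_bernoulli_egf r k x = bernoulli_fps powi r * poly_bernoulli_fps k * fps_exp x"

lemma fps_nth_mixed_bernoulli_egf:
  "fps_nth (mixed_bernoulli_egf r k x) n = poly (mixed_bernoulli_poly r k n) x / fact n"
  by (simp add: mixed_bernoulli_egf_def flip: mixed_bernoulli_poly_generating_function)

text \<open>The three summands come from differentiating b^r, e^(xt) and P_k in turn. The factor b
  in the derivative of P_k raises the order from \<open>r\<close> to \<open>r + 1\<close>.\<close>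

lemma mixed_bernoulli_egf_deriv:
  "fps_X * fps_deriv (mixed_bernoulli_egf r k x)
     = of_int r * (1 - (bernoulli_fps + fps_X)) * mixed_bernoulli_egf r k x
       + fps_const x * (fps_X * mixed_bernoulli_egf r k x)
       + (mixed_bernoulli_egf (r + 1) (k - 1) x - mixed_bernoulli_egf (r + 1) k x)"
proof -
  define b where "b = bernoulli_fps"
  define R where "R = b powi r"
  define P where "P = poly_bernoulli_fps"
  define E where "E = fps_exp x"
  have b0: "fps_nth b 0 \<noteq> 0"
    by (simp add: b_def bernoulli_fps_nth_0)
  then have "b \<noteq> 0"
    by auto
  have "(fps_X * fps_deriv R) * b = of_int r * (fps_X * fps_deriv b) * R"
    using fps_deriv_power_int[OF b0, of r] by (simp add: R_def ac_simps)
  also have "\<dots> = (of_int r * (1 - (b + fps_X)) * R) * b"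
    unfolding b_def bernoulli_fps_deriv by (simp add: algebra_simps)
  finally have R: "fps_X * fps_deriv R = of_int r * (1 - (b + fps_X)) * R"
    using \<open>b \<noteq> 0\<close> by simp
  have P: "fps_X * fps_deriv (P k) = b * (P (k - 1) - P k)"
    by (simp add: P_def b_def poly_bernoulli_fps_deriv)
  have "fps_X * fps_deriv (R * P k * E)
      = (fps_X * fps_deriv R) * P k * E + R * (fps_X * fps_deriv (P k)) * E
        + fps_const x * (fps_X * (R * P k * E))"
    by (simp add: E_def algebra_simps)
  also have "\<dots> = of_int r * (1 - (b + fps_X)) * (R * P k * E)
        + fps_const x * (fps_X * (R * P k * E)) + (R * b * P (k - 1) * E - R * b * P k * E)"
    unfolding R P by (simp add: algebra_simps)
  finally show ?thesis
    by (simp add: mixed_bernoulli_egf_def fps_power_int_add_1[OF b0] flip: b_def R_def P_def E_def)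
qed

text \<open>A binomial convolution of (-1)^j B_j with \<open>s\<close>. Subtracting 1 removes the
  term l = n, as B_0 = 1; the term l = n - 1 is split off using -B_1 = 1/2.\<close>

lemma fact_mult_nth_bernoulli_reflect_mult:
  assumes "n \<ge> 2"
  shows "fact n * fps_nth ((bernoulli_fps + fps_X - 1) * Abs_fps (\<lambda>l. s l / fact l)) n
    = of_nat n / 2 * s (n - 1)
      + (\<Sum>l=0..n-2. (-1) ^ (n - l) * of_nat (n choose l) * bernoulli_number (n - l) * s l)"
proof -
  obtain m where n: "n = Suc (Suc m)"
    using assms by (metis add_2_eq_Suc le_Suc_ex)
  define c where "c = (\<lambda>l. (-1) ^ (n - l) * of_nat (n choose l) * bernoulli_number (n - l) * s l)"
  have "fact n * (s l / fact l * ((-1) ^ (n - l) * bernoulli_number (n - l) / fact (n - l))) = c l"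
    if "l \<le> n" for l
    using that by (simp add: c_def binomial_fact)
  then have "fact n * fps_nth (Abs_fps (\<lambda>l. s l / fact l) * (bernoulli_fps + fps_X)) n = (\<Sum>l=0..n. c l)"
    unfolding bernoulli_fps_reflect fps_mult_nth sum_distrib_left by (intro sum.cong) simp_all
  then have "fact n * fps_nth ((bernoulli_fps + fps_X - 1) * Abs_fps (\<lambda>l. s l / fact l)) n
      = (\<Sum>l=0..n. c l) - s n"
    by (simp add: algebra_simps)
  also have "(\<Sum>l=0..n. c l) = (\<Sum>l=0..n-2. c l) + c (n - 1) + c n"
    by (simp add: n)
  also have "c (n - 1) = of_nat n / 2 * s (n - 1)"
    using bernoulli_number_1 by (simp add: c_def n algebra_simps)
  also have "c n = s n"
    by (simp add: c_def bernoulli_number_0)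
  finally show ?thesis
    by (simp add: c_def)
qed

theorem theorem3:
  fixes n :: nat and r k :: int
  assumes "n \<ge> 2"
  shows "of_nat n * mixed_bernoulli_poly r k n
       + of_nat n * ([:of_int r / 2:] - [:0, 1:]) * mixed_bernoulli_poly r k (n - 1)
       + of_int r * (\<Sum>l=0..n-2. smult ((-1) ^ (n - l) * of_nat (n choose l) * bernoulli_number (n - l))
                                   (mixed_bernoulli_poly r k l))
       = - mixed_bernoulli_poly (r + 1) k n + mixed_bernoulli_poly (r + 1) (k - 1) n"
    (is "?lhs = ?rhs")
proof -
  define S where "S = (\<lambda>r k l x. poly (mixed_bernoulli_poly r k l) x)"
  \<comment> \<open>Complex polynomials with equal values everywhere are equal, so it suffices to
    fix \<open>x\<close>.\<close>
  have "poly ?lhs x = poly ?rhs x" for x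
  proof -
    define F where "F = (\<lambda>r k. mixed_bernoulli_egf r k x)"
    have F: "F r k = Abs_fps (\<lambda>l. S r k l x / fact l)" for r k
      by (rule fps_ext) (simp add: F_def S_def fps_nth_mixed_bernoulli_egf)
    obtain m where n: "n = Suc m"
      using assms by (cases n) auto
    \<comment> \<open>\<open>of_int r\<close> is written as a constant series so that it can be
      pulled out of a coefficient.\<close>
    have "fps_X * fps_deriv (F r k) + fps_const (of_int r) * ((bernoulli_fps + fps_X - 1) * F r k)
        - fps_const x * (fps_X * F r k) = F (r + 1) (k - 1) - F (r + 1) k"
      unfolding F_def mixed_bernoulli_egf_deriv fps_of_int [symmetric] by (simp add: algebra_simps)
    from arg_cong[OF this, of "\<lambda>G. fact n * fps_nth G n"]
    have "fact n * fps_nth (fps_X * fps_deriv (F r k)) n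
        + of_int r * (fact n * fps_nth ((bernoulli_fps + fps_X - 1) * F r k) n)
        - x * (fact n * fps_nth (fps_X * F r k) n)
        = fact n * fps_nth (F (r + 1) (k - 1)) n - fact n * fps_nth (F (r + 1) k) n"
      unfolding fps_add_nth fps_sub_nth fps_mult_left_const_nth distrib_left right_diff_distrib
      by (simp only: mult.left_commute)
    moreover have "fact n * fps_nth (fps_X * fps_deriv (F r k)) n = of_nat n * S r k n x"
      by (simp add: F n)
    \<comment> \<open>The shift by \<open>fps_X\<close> leaves the quotient n! / (n-1)! = n.\<close>
    moreover have "fact n * fps_nth (fps_X * F r k) n = of_nat n * S r k (n - 1) x"
      by (simp add: F n)
    moreover have "fact n * fps_nth (F (r + 1) j) n = S (r + 1) j n x" for j
      by (simp add: F)
    moreover note fact_mult_nth_bernoulli_reflect_mult[OF assms, of "\<lambda>l. S r k l x", folded F]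
    ultimately have "of_nat n * S r k n x
        + of_int r * (of_nat n / 2 * S r k (n - 1) x
          + (\<Sum>l=0..n-2. (-1) ^ (n - l) * of_nat (n choose l) * bernoulli_number (n - l) * S r k l x))
        - x * (of_nat n * S r k (n - 1) x)
        = S (r + 1) (k - 1) n x - S (r + 1) k n x"
      by simp
    then show ?thesis
      by (simp add: S_def poly_sum algebra_simps)
  qed
  then show ?thesis
    by (intro poly_eq_poly_eq_iff[THEN iffD1] ext)
qed

end
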